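(* Let $k\ge 0$ be an integer and let $q\in\mathbb{C}\setminus\{0\}$ satisfy $(1)_q(2)_q\cdots(k+1)_q\neq 0$. Let $$\mathcal{H}_{(k,1)}(q)=\rho_{(k,1)}\Big(\sum_{i=1}^{k+1}\sigma_i\Big)-(qk-q^{-1})\,\mathbf{1}\in \mathrm{End}(V_{(k,1)}),$$ where $\rho_{(k,1)}$ is the corner representation of the Hecke algebra $H_{k+2}$ for the Young diagram $\{k+1,1\}$. Then $$\mathrm{Spec}\big(\mathcal{H}_{(k,1)}(q)\big)=\Big\{2\cos\frac{\pi p}{k+2}\ :\ p=1,2,\dots,k+1\Big\}.$$
   Context: For $q\in\mathbb{C}\setminus\{0\}$ and an integer $p\ge 0$, $(p)_q=\frac{q^p-q^{-p}}{q-q^{-1}}=\sum_{j=0}^{p-1}q^{p-1-2j}$ (the last expression is used when $q^2=1$); $(0)_q=0$. The Hecke algebra $H_{n+1}$ (with parameter $q$) is the unital associative $\mathbb{C}$-algebra generated by $\sigma_1,\dots,\sigma_n$ with relations $\sigma_i\sigma_{i+1}\sigma_i=\sigma_{i+1}\sigma_i\sigma_{i+1}$, $\sigma_i\sigma_j=\sigma_j\sigma_i$ for $|i-j|>1$, $\sigma_i^2=(q-q^{-1})\sigma_i+1$. Corner representation $\rho_{(k,1)}$ of $H_{k+2}$: its space $V_{(k,1)}$ is the complex vector space with basis $v_2,v_3,\dots,v_{k+2}$, and for $1\le p\le k+1$: $\rho_{(k,1)}(\sigma_p)v_i=q\,v_i$ if $i\ne p,p+1$; $\rho_{(k,1)}(\sigma_p)v_{p+1}=-\frac{q^{-p}}{(p)_q}v_{p+1}+\frac{(p-1)_q}{(p)_q}v_{p}$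 (for $p=1$ the second term has coefficient $(0)_q=0$ and is omitted); $\rho_{(k,1)}(\sigma_p)v_p=\frac{q^{p}}{(p)_q}v_p+\frac{(p+1)_q}{(p)_q}v_{p+1}$ for $p\ge 2$. *)

theory Defs
  imports
    "HOL-Library.Poly_Mapping"
    "HOL-Algebra.QuotRing"
    "Jordan_Normal_Form.Spectral_Radius"
begin

section \<open>Symmetric quantum integers\<close>

text \<open>The sum is the form that is meaningful for every nonzero \<open>q\<close>, including \<open>q\<^sup>2 = 1\<close>.\<close>

definition qint :: "complex \<Rightarrow> nat \<Rightarrow> complex" where
  "qint q p = (\<Sum>j<p. q powi (int p - 1 - 2 * int j))"

lemma qint_0 [simp]: "qint q 0 = 0"
  by (simp add: qint_def)

lemma qint_Suc:
  assumes "q \<noteq> 0"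
  shows "qint q (Suc p) = q * qint q p + inverse q ^ p"
proof -
  have "(\<Sum>j<p. q powi (int (Suc p) - 1 - 2 * int j)) = q * qint q p"
    unfolding qint_def sum_distrib_left
    by (intro sum.cong) (use assms in \<open>auto simp flip: power_int_add_1'\<close>)
  moreover have "q powi (int (Suc p) - 1 - 2 * int p) = inverse q ^ p"
    by (simp add: power_int_def power_inverse)
  ultimately show ?thesis
    by (simp add: qint_def)
qed

lemma qint_Suc':
  assumes "q \<noteq> 0"
  shows "qint q (Suc p) = inverse q * qint q p + q ^ p"
proof (induction p)
  case 0
  then show ?case by (simp add: qint_def)
next
  case (Suc p)
  have "qint q (Suc (Suc p)) = q * qint q (Suc p) + inverse q ^ Suc p"
    by (rule qint_Suc[OF assms])
  also have "\<dots> = q * (inverse q * qint q p + q ^ p) + inverse q ^ Suc p"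
    using Suc by simp
  also have "\<dots> = inverse q * (q * qint q p + inverse q ^ p) + q ^ Suc p"
    using assms by (simp add: algebra_simps)
  also have "\<dots> = inverse q * qint q (Suc p) + q ^ Suc p"
    using qint_Suc[OF assms] by simp
  finally show ?case .
qed

lemma qint_eq_quotient:
  assumes "q \<noteq> 0" "q\<^sup>2 \<noteq> 1"
  shows "qint q p = (q ^ p - inverse q ^ p) / (q - inverse q)"
proof -
  have "q - inverse q \<noteq> 0"
    using assms by (auto simp: field_simps power2_eq_square)
  moreover have "(q - inverse q) * qint q p = q ^ p - inverse q ^ p"
    using qint_Suc[OF assms(1), of p] qint_Suc'[OF assms(1), of p] by (simp add: algebra_simps)
  ultimately show ?thesis by (simp add: field_simps)
qed

section \<open>The Hecke algebra\<close>

text \<open>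
  The free unital associative algebra over \<open>\<complex>\<close> on letters indexed by \<open>nat\<close> is the algebra of
  finitely supported functions on words; \<open>'k \<Rightarrow>\<^sub>0 'a\<close> carries the convolution product as soon as
  \<open>'k\<close> is an (additively written) monoid, so words get concatenation as \<open>+\<close>.
\<close>

datatype word = Word (letters: "nat list")

instantiation word :: monoid_add
begin
definition zero_word :: word where "0 = Word []"
definition plus_word :: "word \<Rightarrow> word \<Rightarrow> word" where "v + w = Word (letters v @ letters w)"
instance by standard (auto simp: zero_word_def plus_word_def)
end

lemma letters_0 [simp]: "letters 0 = []"
  and letters_plus [simp]: "letters (v + w) = letters v @ letters w"
  by (simp_all add: zero_word_def plus_word_def)

type_synonym free_elem = "word \<Rightarrow>\<^sub>0 complex"

definition scalar :: "complex \<Rightarrow> free_elem" where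
  "scalar c = Poly_Mapping.single 0 c"

definition gen :: "nat \<Rightarrow> free_elem" where
  "gen i = Poly_Mapping.single (Word [i]) 1"

text \<open>The free algebra on the letters \<open>1, \<dots>, m - 1\<close>.\<close>

definition free_algebra :: "nat \<Rightarrow> free_elem ring" where
  "free_algebra m =
     \<lparr>carrier = {x. \<forall>w \<in> Poly_Mapping.keys x. set (letters w) \<subseteq> {1..<m}},
      monoid.mult = (*), one = 1, zero = 0, add = (+)\<rparr>"

definition hecke_relators :: "complex \<Rightarrow> nat \<Rightarrow> free_elem set" where
  "hecke_relators q m =
     {gen i * gen (i + 1) * gen i - gen (i + 1) * gen i * gen (i + 1) |i.
        i \<in> {1..<m} \<and> i + 1 \<in> {1..<m}} \<union>
     {gen i * gen j - gen j * gen i |i j.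
        i \<in> {1..<m} \<and> j \<in> {1..<m} \<and> \<bar>int i - int j\<bar> > 1} \<union>
     {gen i * gen i - (scalar (q - inverse q) * gen i + 1) |i. i \<in> {1..<m}}"

definition hecke_ideal :: "complex \<Rightarrow> nat \<Rightarrow> free_elem set" where
  "hecke_ideal q m = genideal (free_algebra m) (hecke_relators q m)"

text \<open>
  \<open>hecke_algebra q m\<close> is \<open>H\<^sub>m\<close>, with \<open>m - 1\<close> generators. Its underlying ring is a HOL-Algebra
  quotient by a two-sided ideal; the scalar \<open>c\<close> is the class of \<open>scalar c\<close>.
\<close>

definition hecke_algebra :: "complex \<Rightarrow> nat \<Rightarrow> free_elem set ring" where
  "hecke_algebra q m = free_algebra m Quot hecke_ideal q m"

definition hecke_class :: "complex \<Rightarrow> nat \<Rightarrow> free_elem \<Rightarrow> free_elem set" where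
  "hecke_class q m x = hecke_ideal q m +>\<^bsub>free_algebra m\<^esub> x"

definition hecke_sigma :: "complex \<Rightarrow> nat \<Rightarrow> nat \<Rightarrow> free_elem set" where
  "hecke_sigma q m i = hecke_class q m (gen i)"

section \<open>The corner representation\<close>

text \<open>
  \<open>corner_coeff q p i j\<close> is the coefficient of \<open>v\<^sub>j\<close> in \<open>\<rho>(\<sigma>\<^sub>p) v\<^sub>i\<close>. The indices \<open>i\<close>, \<open>j\<close> range over
  \<open>2, \<dots>, k + 2\<close>, so for \<open>p = 1\<close> the branches mentioning \<open>v\<^sub>p\<close> are never reached.
\<close>

definition corner_coeff :: "complex \<Rightarrow> nat \<Rightarrow> nat \<Rightarrow> nat \<Rightarrow> complex" where
  "corner_coeff q p i j =
     (if i = p + 1 then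
        (if j = p + 1 then - (inverse q ^ p / qint q p)
         else if j = p then qint q (p - 1) / qint q p
         else 0)
      else if i = p then
        (if j = p then q ^ p / qint q p
         else if j = p + 1 then qint q (p + 1) / qint q p
         else 0)
      else if j = i then q else 0)"

text \<open>
  \<open>End(V)\<close> is the ring of square matrices of size \<open>k + 1\<close> in the basis \<open>v\<^sub>2, \<dots>, v\<^bsub>k+2\<^esub>\<close>. Matrix indices
  start at 0, so row or column \<open>r\<close> belongs to \<open>v\<^bsub>r+2\<^esub>\<close>, and columns are images of basis vectors.
\<close>

definition corner_gen :: "complex \<Rightarrow> nat \<Rightarrow> nat \<Rightarrow> complex mat" where
  "corner_gen q k p = mat (k + 1) (k + 1) (\<lambda>(r, c). corner_coeff q p (c + 2) (r + 2))"

definition corner_word :: "complex \<Rightarrow> nat \<Rightarrow> word \<Rightarrow> complex mat" where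
  "corner_word q k w = foldr (\<lambda>p M. corner_gen q k p * M) (letters w) (1\<^sub>m (k + 1))"

text \<open>The extension to the free algebra as a homomorphism of unital \<open>\<complex>\<close>-algebras.\<close>

definition corner_free :: "complex \<Rightarrow> nat \<Rightarrow> free_elem \<Rightarrow> complex mat" where
  "corner_free q k x =
     mat (k + 1) (k + 1)
       (\<lambda>rc. \<Sum>w \<in> Poly_Mapping.keys x. Poly_Mapping.lookup x w * corner_word q k w $$ rc)"

text \<open>
  An element of the Hecke algebra is a coset, on which \<open>corner_free\<close> is constant when
  \<open>(1)\<^sub>q \<dots> (k + 1)\<^sub>q \<noteq> 0\<close>; see \<open>corner_rep_class\<close>, \<open>corner_rep_hom\<close>, \<open>corner_rep_sigma\<close> and
  \<open>corner_rep_scalar\<close> below.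
\<close>

definition corner_rep :: "complex \<Rightarrow> nat \<Rightarrow> free_elem set \<Rightarrow> complex mat" where
  "corner_rep q k X = the_elem (corner_free q k ` X)"

definition corner_hamiltonian :: "complex \<Rightarrow> nat \<Rightarrow> complex mat" where
  "corner_hamiltonian q k =
     corner_rep q k
       (\<Oplus>\<^bsub>hecke_algebra q (k + 2)\<^esub>i \<in> {1..k + 1}. hecke_sigma q (k + 2) i)
     - (q * of_nat k - inverse q) \<cdot>\<^sub>m 1\<^sub>m (k + 1)"

section \<open>Well-definedness of the corner representation\<close>

lemma free_algebra_simps [simp]:
  "carrier (free_algebra m) = {x. \<forall>w \<in> Poly_Mapping.keys x. set (letters w) \<subseteq> {1..<m}}"
  "x \<otimes>\<^bsub>free_algebra m\<^esub> y = x * y" "x \<oplus>\<^bsub>free_algebra m\<^esub> y = x + y"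
  "\<one>\<^bsub>free_algebra m\<^esub> = 1" "\<zero>\<^bsub>free_algebra m\<^esub> = 0"
  by (simp_all add: free_algebra_def)

lemma ring_free_algebra: "ring (free_algebra m)"
proof (rule ringI)
  show "abelian_group (free_algebra m)"
  proof (rule abelian_groupI)
    fix x assume "x \<in> carrier (free_algebra m)"
    then show "\<exists>y\<in>carrier (free_algebra m). y \<oplus>\<^bsub>free_algebra m\<^esub> x = \<zero>\<^bsub>free_algebra m\<^esub>"
      by (intro bexI[of _ "- x"]) (auto simp: in_keys_iff)
  next
    fix x y
    assume "x \<in> carrier (free_algebra m)" "y \<in> carrier (free_algebra m)"
    then show "x \<oplus>\<^bsub>free_algebra m\<^esub> y \<in> carrier (free_algebra m)"
      using Poly_Mapping.keys_add[of x y] by fastforce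
  qed (auto simp: algebra_simps)
  show "Group.monoid (free_algebra m)"
  proof (rule monoidI)
    fix x y
    assume *: "x \<in> carrier (free_algebra m)" "y \<in> carrier (free_algebra m)"
    have "set (letters w) \<subseteq> {1..<m}" if w: "w \<in> Poly_Mapping.keys (x * y)" for w
    proof -
      obtain a b where "w = a + b" "a \<in> Poly_Mapping.keys x" "b \<in> Poly_Mapping.keys y"
        using keys_mult[of x y] w by blast
      then show ?thesis using * by simp
    qed
    then show "x \<otimes>\<^bsub>free_algebra m\<^esub> y \<in> carrier (free_algebra m)" by simp
  qed (auto simp: algebra_simps)
qed (auto simp: algebra_simps)

lemma scalar_carrier: "scalar c \<in> carrier (free_algebra m)"
  by (auto simp: scalar_def)

lemma gen_carrier: "i \<in> {1..<m} \<Longrightarrow> gen i \<in> carrier (free_algebra m)"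
  by (auto simp: gen_def)

lemma free_minus_carrier:
  assumes "x \<in> carrier (free_algebra m)" "y \<in> carrier (free_algebra m)"
  shows "x - y \<in> carrier (free_algebra m)"
proof -
  interpret ring "free_algebra m" by (rule ring_free_algebra)
  have "- y \<in> carrier (free_algebra m)"
    using assms(2) by (auto simp: in_keys_iff)
  from a_closed[OF assms(1) this] show ?thesis by (simp only: free_algebra_simps(3)) simp
qed

lemma hecke_relators_carrier: "hecke_relators q m \<subseteq> carrier (free_algebra m)"
proof -
  interpret ring "free_algebra m" by (rule ring_free_algebra)
  have mult: "x * y \<in> carrier (free_algebra m)"
    if "x \<in> carrier (free_algebra m)" "y \<in> carrier (free_algebra m)" for x y
    using m_closed[OF that] by (simp only: free_algebra_simps(2))
  have add: "x + y \<in> carrier (free_algebra m)"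
    if "x \<in> carrier (free_algebra m)" "y \<in> carrier (free_algebra m)" for x y
    using a_closed[OF that] by (simp only: free_algebra_simps(3))
  have one: "1 \<in> carrier (free_algebra m)"
    using one_closed by (simp only: free_algebra_simps(4))
  show ?thesis
    unfolding hecke_relators_def
    by (intro Un_least subsetI; elim CollectE exE conjE; hypsubst;
        intro free_minus_carrier mult add one gen_carrier scalar_carrier; assumption)
qed

lemma ideal_hecke_ideal: "ideal (hecke_ideal q m) (free_algebra m)"
  unfolding hecke_ideal_def
  by (rule ring.genideal_ideal[OF ring_free_algebra hecke_relators_carrier])

lemma ring_hecke_algebra: "ring (hecke_algebra q m)"
  unfolding hecke_algebra_def by (rule ideal.quotient_is_ring[OF ideal_hecke_ideal])

lemma hecke_class_hom: "hecke_class q m \<in> Ring.ring_hom (free_algebra m) (hecke_algebra q m)"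
  unfolding hecke_class_def hecke_algebra_def
  using ideal.rcos_ring_hom[OF ideal_hecke_ideal] by simp

lemma corner_gen_carrier [simp]: "corner_gen q k p \<in> carrier_mat (k + 1) (k + 1)"
  by (simp add: corner_gen_def)

lemma corner_free_carrier [simp]: "corner_free q k x \<in> carrier_mat (k + 1) (k + 1)"
  by (simp add: corner_free_def)

lemma foldr_corner_carrier:
  "M \<in> carrier_mat (k + 1) (k + 1) \<Longrightarrow>
     foldr (\<lambda>p M. corner_gen q k p * M) ps M \<in> carrier_mat (k + 1) (k + 1)"
  by (induction ps) (simp_all add: mult_carrier_mat[OF corner_gen_carrier] del: One_nat_def add_Suc_right)

lemma corner_word_carrier [simp]: "corner_word q k w \<in> carrier_mat (k + 1) (k + 1)"
  unfolding corner_word_def by (rule foldr_corner_carrier) simp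

lemma corner_word_plus: "corner_word q k (v + w) = corner_word q k v * corner_word q k w"
proof -
  have "foldr (\<lambda>p M. corner_gen q k p * M) ps M =
      foldr (\<lambda>p M. corner_gen q k p * M) ps (1\<^sub>m (k + 1)) * M"
    if "M \<in> carrier_mat (k + 1) (k + 1)" for ps M
  proof (induction ps)
    case Nil
    then show ?case using that by simp
  next
    case (Cons p ps)
    then show ?case
      using assoc_mult_mat[OF corner_gen_carrier foldr_corner_carrier[OF one_carrier_mat] that]
      by simp
  qed
  from this[of "corner_word q k w"] show ?thesis
    using corner_word_carrier[of q k w] by (simp add: corner_word_def)
qed

lemma corner_free_superset:
  assumes "finite A" "Poly_Mapping.keys x \<subseteq> A"
  shows "corner_free q k x =
    mat (k + 1) (k + 1) (\<lambda>rc. \<Sum>w \<in> A. Poly_Mapping.lookup x w * corner_word q k w $$ rc)"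
  unfolding corner_free_def
  by (intro eq_matI) (auto intro!: sum.mono_neutral_left assms simp: in_keys_iff)

lemma corner_free_add: "corner_free q k (x + y) = corner_free q k x + corner_free q k y"
proof -
  let ?A = "Poly_Mapping.keys x \<union> Poly_Mapping.keys y"
  have "finite ?A" by simp
  note * = corner_free_superset[OF this]
  show ?thesis
    by (subst (1 2 3) *)
      (auto intro!: eq_matI simp: Poly_Mapping.lookup_add algebra_simps sum.distrib
        dest: subsetD[OF Poly_Mapping.keys_add])
qed

lemma corner_free_single:
  "corner_free q k (Poly_Mapping.single w c) = c \<cdot>\<^sub>m corner_word q k w"
proof -
  have "Poly_Mapping.keys (Poly_Mapping.single w c) \<subseteq> {w}" by simp
  note corner_free_superset[OF _ this, of q k]
  with corner_word_carrier[of q k w] show ?thesis by (auto intro!: eq_matI)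
qed

lemma corner_free_scalar: "corner_free q k (scalar c) = c \<cdot>\<^sub>m 1\<^sub>m (k + 1)"
  by (simp add: scalar_def corner_free_single corner_word_def)

lemma corner_free_one: "corner_free q k 1 = 1\<^sub>m (k + 1)"
  using corner_free_scalar[of q k 1] by (auto simp: scalar_def intro!: eq_matI)

lemma corner_free_zero: "corner_free q k 0 = 0\<^sub>m (k + 1) (k + 1)"
  by (auto simp: corner_free_def)

lemma corner_free_gen: "corner_free q k (gen p) = corner_gen q k p"
  using corner_gen_carrier[of q k p]
  by (auto simp: gen_def corner_free_single corner_word_def right_mult_one_mat intro!: eq_matI)

lemma free_elem_induct [case_names zero single add]:
  fixes x :: free_elem
  assumes "P 0" "\<And>w c. P (Poly_Mapping.single w c)" "\<And>x y. P x \<Longrightarrow> P y \<Longrightarrow> P (x + y)"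
  shows "P x"
proof (induction x rule: Poly_Mapping.update_induct)
  case const
  show ?case by (rule assms(1))
next
  case (update f a b)
  have "Poly_Mapping.update a b f = f + Poly_Mapping.single a b"
    using update by (intro poly_mapping_eqI)
      (auto simp: lookup_update Poly_Mapping.lookup_add lookup_single in_keys_iff when_def)
  then show ?case using assms(3)[OF update(3) assms(2)] by simp
qed

lemma corner_free_mult: "corner_free q k (x * y) = corner_free q k x * corner_free q k y"
proof (induction x rule: free_elem_induct)
  case zero
  then show ?case using left_mult_zero_mat[OF corner_free_carrier] by (simp add: corner_free_zero)
next
  case (add a b)
  then show ?case
    by (simp add: distrib_right corner_free_add
        add_mult_distrib_mat[OF corner_free_carrier corner_free_carrier corner_free_carrier])
next
  case (single w c)
  show ?case
  proof (induction y rule: free_elem_induct)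
    case zero
    then show ?case
      using right_mult_zero_mat[OF corner_free_carrier] by (simp add: corner_free_zero)
  next
    case (add a b)
    then show ?case
      by (simp add: distrib_left corner_free_add
          mult_add_distrib_mat[OF corner_free_carrier corner_free_carrier corner_free_carrier])
  next
    case (single w' c')
    show ?case
      using corner_word_carrier[of q k w] corner_word_carrier[of q k w']
      by (simp add: mult_single corner_free_single corner_word_plus
          mult_smult_assoc_mat[OF corner_word_carrier]
          mult_smult_distrib[OF corner_word_carrier corner_word_carrier]
          smult_carrier_mat[OF corner_word_carrier])
        (auto intro!: eq_matI simp: algebra_simps)
  qed
qed

lemma corner_free_hom:
  "corner_free q k \<in> Ring.ring_hom (free_algebra m) (ring_mat TYPE(complex) (k + 1) ())"
  by (rule ring_hom_memI)
    (simp_all add: ring_mat_simps corner_free_add corner_free_mult corner_free_one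
       del: One_nat_def)

text \<open>
  \<open>\<rho>(\<sigma>\<^sub>p) - q\<close> has rank one: it is the functional \<open>f \<mapsto> f p - f (p + 1)\<close> times the vector
  \<open>corner_vec q p\<close>, and these operators satisfy the Temperley-Lieb relations.
\<close>

definition corner_vec :: "complex \<Rightarrow> nat \<Rightarrow> nat \<Rightarrow> complex" where
  "corner_vec q p j =
     (if j = p then - (qint q (p - 1) / qint q p)
      else if j = p + 1 then qint q (p + 1) / qint q p else 0)"

definition corner_act :: "complex \<Rightarrow> nat \<Rightarrow> (nat \<Rightarrow> complex) \<Rightarrow> nat \<Rightarrow> complex" where
  "corner_act q p f j = q * f j + (f p - f (p + 1)) * corner_vec q p j"

lemma qint_pred:
  assumes "q \<noteq> 0" "p \<ge> 1"
  shows "qint q (p - 1) = q * qint q p - q ^ p"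
proof -
  obtain r where p: "p = Suc r" using assms(2) by (cases p) auto
  show ?thesis
    using qint_Suc'[OF assms(1), of r] assms(1) by (simp add: p field_simps)
qed

lemma corner_coeff_eq:
  assumes "q \<noteq> 0" "p \<ge> 1" "qint q p \<noteq> 0"
  shows "corner_coeff q p i j =
    (if i = j then q else 0) +
    ((if i = p then 1 else 0) - (if i = p + 1 then 1 else 0)) * corner_vec q p j"
  using qint_pred[OF assms(1,2)] qint_Suc[OF assms(1), of p] assms(3)
  by (auto simp: corner_coeff_def corner_vec_def field_simps)

lemma corner_vec_diff:
  assumes "q \<noteq> 0" "p \<ge> 1" "qint q p \<noteq> 0"
  shows "corner_vec q p p - corner_vec q p (p + 1) = - (q + inverse q)"
  using qint_pred[OF assms(1,2)] qint_Suc'[OF assms(1), of p] assms(3)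
  by (simp add: corner_vec_def divide_simps) (simp add: assms(1) algebra_simps)

lemma corner_act_quadratic:
  assumes "q \<noteq> 0" "p \<ge> 1" "qint q p \<noteq> 0"
  shows "corner_act q p (corner_act q p f) j = (q - inverse q) * corner_act q p f j + f j"
proof -
  define i where "i = inverse q"
  have i: "q * i = 1" using assms by (simp add: i_def)
  have *: "corner_vec q p p = corner_vec q p (p + 1) - q - i"
    using corner_vec_diff[OF assms] by (simp add: i_def algebra_simps)
  have "q * (q * h + (a - b) * v) + (q * a + (a - b) * (B - q - i) - (q * b + (a - b) * B)) * v =
      (q - i) * (q * h + (a - b) * v) + q * i * h" for h a b v B :: complex
    by (simp add: algebra_simps)
  from this[of "f j" "f p" "f (p + 1)" "corner_vec q p j" "corner_vec q p (p + 1)"] i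
  show ?thesis
    unfolding corner_act_def * i_def[symmetric] by (simp only: mult_1)
qed

lemma corner_act_commute:
  assumes "\<bar>int i - int j\<bar> > 1"
  shows "corner_act q i (corner_act q j f) l = corner_act q j (corner_act q i f) l"
proof -
  have "corner_vec q i j = 0" "corner_vec q i (j + 1) = 0"
    "corner_vec q j i = 0" "corner_vec q j (i + 1) = 0"
    using assms by (auto simp: corner_vec_def)
  then show ?thesis by (simp add: corner_act_def algebra_simps)
qed

lemma corner_act_braid:
  assumes "q \<noteq> 0" "p \<ge> 1" "qint q p \<noteq> 0" "qint q (p + 1) \<noteq> 0"
  shows "corner_act q p (corner_act q (p + 1) (corner_act q p f)) j =
    corner_act q (p + 1) (corner_act q p (corner_act q (p + 1) f)) j"
proof -
  define i where "i = inverse q"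
  define B C where "B = corner_vec q p (p + 1)" and "C = corner_vec q (p + 1) (p + 1)"
  have i: "q * i = 1" using assms by (simp add: i_def)
  have BC: "B * C = - 1"
    using assms by (simp add: B_def C_def corner_vec_def)
  have 1: "corner_vec q p p = B - q - i"
    using corner_vec_diff[OF assms(1-3)] by (simp add: i_def B_def algebra_simps)
  have 2: "corner_vec q (p + 1) (p + 1 + 1) = C + q + i"
    using corner_vec_diff[of q "p + 1"] assms by (simp add: i_def C_def algebra_simps)
  have 3: "corner_vec q p (p + 1 + 1) = 0" "corner_vec q (p + 1) p = 0"
    by (simp_all add: corner_vec_def)
  have "q * (q * (q * h + (a - b) * v) + (q * b + (a - b) * B - (q * c + (a - b) * 0)) * w) +
      (q * (q * a + (a - b) * (B - q - i)) + (q * b + (a - b) * B - (q * c + (a - b) * 0)) * 0 -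
       (q * (q * b + (a - b) * B) + (q * b + (a - b) * B - (q * c + (a - b) * 0)) * C)) * v =
      q * (q * (q * h + (b - c) * w) + (q * a + (b - c) * 0 - (q * b + (b - c) * C)) * v) +
      (q * (q * b + (b - c) * C) + (q * a + (b - c) * 0 - (q * b + (b - c) * C)) * B -
       (q * (q * c + (b - c) * (C + q + i)) + (q * a + (b - c) * 0 - (q * b + (b - c) * C)) * 0)) * w
      - (B * C + q * i) * ((a - b) * v - (b - c) * w)"
    for h a b c v w :: complex
    by (simp add: algebra_simps)
  from this[of "f j" "f p" "f (p + 1)" "corner_vec q p j" "f (p + 1 + 1)" "corner_vec q (p + 1) j"]
  show ?thesis
    unfolding corner_act_def 1 2 3 B_def[symmetric] C_def[symmetric] i BC
    by (simp only: add.left_inverse mult_zero_left diff_zero)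
qed

definition corner_col :: "nat \<Rightarrow> complex mat \<Rightarrow> nat \<Rightarrow> nat \<Rightarrow> complex" where
  "corner_col k M c j = (if j \<in> {2..k + 2} then M $$ (j - 2, c) else 0)"

lemma corner_col_mult:
  assumes "q \<noteq> 0" "p \<in> {1..<k + 2}" "qint q p \<noteq> 0" "M \<in> carrier_mat (k + 1) (k + 1)" "c < k + 1"
  shows "corner_col k (corner_gen q k p * M) c = corner_act q p (corner_col k M c)"
proof
  fix j
  show "corner_col k (corner_gen q k p * M) c j = corner_act q p (corner_col k M c) j"
  proof (cases "j \<in> {2..k + 2}")
    case True
    let ?F = "corner_col k M c" and ?v = "corner_vec q p j"
    have "corner_col k (corner_gen q k p * M) c j =
        (\<Sum>s<k + 1. corner_coeff q p (s + 2) j * M $$ (s, c))"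
      using True assms(4,5)
      by (auto simp: corner_col_def corner_gen_def scalar_prod_def lessThan_atLeast0
          simp del: add_2_eq_Suc' intro!: sum.cong)
    also have "\<dots> = (\<Sum>i\<in>{2..k + 2}. corner_coeff q p i j * ?F i)"
      by (rule sum.reindex_bij_witness[of _ "\<lambda>i. i - 2" "\<lambda>s. s + 2"])
        (auto simp: corner_col_def)
    also have "\<dots> = (\<Sum>i\<in>{2..k + 2}. (if i = j then q * ?F i else 0)
        + (if i = p then ?F i * ?v else 0) - (if i = p + 1 then ?F i * ?v else 0))"
      using assms by (intro sum.cong) (auto simp: corner_coeff_eq algebra_simps)
    also have "\<dots> = q * ?F j + (if p \<in> {2..k + 2} then ?F p * ?v else 0)
        - (if p + 1 \<in> {2..k + 2} then ?F (p + 1) * ?v else 0)"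
      using True by (simp only: sum.distrib sum_subtractf sum.delta[OF finite_atLeastAtMost] if_True)
    also have "\<dots> = corner_act q p ?F j"
      by (auto simp: corner_act_def corner_col_def algebra_simps)
    finally show ?thesis .
  next
    case False
    then show ?thesis
      using assms(2) by (auto simp: corner_act_def corner_col_def corner_vec_def)
  qed
qed

lemma corner_mat_eqI:
  assumes "A \<in> carrier_mat (k + 1) (k + 1)" "B \<in> carrier_mat (k + 1) (k + 1)"
    and "\<And>c. c < k + 1 \<Longrightarrow> corner_col k A c = corner_col k B c"
  shows "A = B"
proof (rule eq_matI)
  fix r c assume "r < dim_row B" "c < dim_col B"
  with assms(1,2) have "r < k + 1" "c < k + 1" by auto
  with fun_cong[OF assms(3)[OF this(2)], of "r + 2"] show "A $$ (r, c) = B $$ (r, c)"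
    by (simp add: corner_col_def)
qed (use assms in auto)

context
  fixes q :: complex and k :: nat
  assumes q: "q \<noteq> 0" and nz: "(\<Prod>p = 1..k + 1. qint q p) \<noteq> 0"
begin

lemma qint_nz: "p \<in> {1..<k + 2} \<Longrightarrow> qint q p \<noteq> 0"
  using nz by (subst (asm) prod_zero_iff) auto

lemma corner_free_relator:
  assumes "x \<in> hecke_relators q (k + 2)"
  shows "corner_free q k x = 0\<^sub>m (k + 1) (k + 1)"
proof -
  let ?S = "corner_gen q k"
  have diff: "corner_free q k (a - b) = 0\<^sub>m (k + 1) (k + 1)"
    if "corner_free q k a = corner_free q k b" for a b
  proof -
    have "corner_free q k (a - b) + corner_free q k b = corner_free q k b"
      using corner_free_add[of q k "a - b" b] that by simp
    moreover have "(corner_free q k (a - b) + corner_free q k b) $$ (r, c) =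
        corner_free q k (a - b) $$ (r, c) + corner_free q k b $$ (r, c)"
      if "r < k + 1" "c < k + 1" for r c
      using corner_free_carrier[of q k b] that by (intro index_add_mat) auto
    ultimately show ?thesis
      using corner_free_carrier[of q k "a - b"] by (intro eq_matI) auto
  qed
  have carr: "A * B \<in> carrier_mat (k + 1) (k + 1)"
    if "A \<in> carrier_mat (k + 1) (k + 1)" "B \<in> carrier_mat (k + 1) (k + 1)"
    for A B :: "complex mat" using that by (rule mult_carrier_mat)
  define e where "e = corner_col k (1\<^sub>m (k + 1))"
  have col1: "corner_col k (?S i) c = corner_act q i (e c)"
    if "i \<in> {1..<k + 2}" "c < k + 1" for i c
    using corner_col_mult[OF q that(1) qint_nz[OF that(1)] one_carrier_mat that(2)]
    unfolding e_def right_mult_one_mat[OF corner_gen_carrier] .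
  have col2: "corner_col k (?S i * ?S j) c = corner_act q i (corner_act q j (e c))"
    if "i \<in> {1..<k + 2}" "j \<in> {1..<k + 2}" "c < k + 1" for i j c
    using corner_col_mult[OF q that(1) qint_nz[OF that(1)] corner_gen_carrier[of q k j] that(3)]
    by (simp only: col1[OF that(2,3)])
  have col3: "corner_col k (?S i * (?S j * ?S l)) c =
      corner_act q i (corner_act q j (corner_act q l (e c)))"
    if "i \<in> {1..<k + 2}" "j \<in> {1..<k + 2}" "l \<in> {1..<k + 2}" "c < k + 1" for i j l c
    using corner_col_mult[OF q that(1) qint_nz[OF that(1)]
        carr[OF corner_gen_carrier[of q k j] corner_gen_carrier[of q k l]] that(4)]
    by (simp only: col2[OF that(2,3,4)])
  consider
    (braid) i where "i \<in> {1..<k + 2}" "i + 1 \<in> {1..<k + 2}"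
      "x = gen i * gen (i + 1) * gen i - gen (i + 1) * gen i * gen (i + 1)" |
    (commute) i j where "i \<in> {1..<k + 2}" "j \<in> {1..<k + 2}" "\<bar>int i - int j\<bar> > 1"
      "x = gen i * gen j - gen j * gen i" |
    (quadratic) i where "i \<in> {1..<k + 2}"
      "x = gen i * gen i - (scalar (q - inverse q) * gen i + 1)"
    using assms unfolding hecke_relators_def by blast
  then show ?thesis
  proof cases
    case braid
    have mats: "?S i * (?S (i + 1) * ?S i) = ?S (i + 1) * (?S i * ?S (i + 1))"
    proof (rule corner_mat_eqI[of _ k])
      fix c assume c: "c < k + 1"
      show "corner_col k (?S i * (?S (i + 1) * ?S i)) c =
        corner_col k (?S (i + 1) * (?S i * ?S (i + 1))) c"
        unfolding col3[OF braid(1,2,1) c] col3[OF braid(2,1,2) c]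
        using braid(1) qint_nz[OF braid(1)] qint_nz[OF braid(2)]
        by (intro ext corner_act_braid q) auto
    qed (intro carr corner_gen_carrier)+
    show ?thesis
      unfolding braid(3)
      by (rule diff)
        (simp only: corner_free_mult corner_free_gen mats
          assoc_mult_mat[OF corner_gen_carrier corner_gen_carrier corner_gen_carrier])
  next
    case commute
    have "?S i * ?S j = ?S j * ?S i"
    proof (rule corner_mat_eqI[of _ k])
      fix c assume c: "c < k + 1"
      show "corner_col k (?S i * ?S j) c = corner_col k (?S j * ?S i) c"
        unfolding col2[OF commute(1,2) c] col2[OF commute(2,1) c]
        by (intro ext corner_act_commute commute(3))
    qed (intro carr corner_gen_carrier)+
    then show ?thesis
      unfolding commute(4) by (intro diff) (simp only: corner_free_mult corner_free_gen)
  next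
    case quadratic
    let ?T = "(q - inverse q) \<cdot>\<^sub>m 1\<^sub>m (k + 1) * ?S i + 1\<^sub>m (k + 1)"
    have T: "?T = (q - inverse q) \<cdot>\<^sub>m ?S i + 1\<^sub>m (k + 1)"
      using mult_smult_assoc_mat[OF one_carrier_mat corner_gen_carrier]
        left_mult_one_mat[OF corner_gen_carrier] by simp
    have "?S i * ?S i = ?T"
      unfolding T
    proof (rule corner_mat_eqI[of _ k])
      fix c assume c: "c < k + 1"
      have "corner_col k ((q - inverse q) \<cdot>\<^sub>m ?S i + 1\<^sub>m (k + 1)) c =
          (\<lambda>j. (q - inverse q) * corner_col k (?S i) c j + e c j)"
        using corner_gen_carrier[of q k i] c by (auto simp: corner_col_def e_def fun_eq_iff)
      then show "corner_col k (?S i * ?S i) c =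
          corner_col k ((q - inverse q) \<cdot>\<^sub>m ?S i + 1\<^sub>m (k + 1)) c"
        unfolding col2[OF quadratic(1,1) c] col1[OF quadratic(1) c]
        using quadratic(1) qint_nz[OF quadratic(1)] q
        by (auto intro!: ext corner_act_quadratic)
    next
      show "?S i * ?S i \<in> carrier_mat (k + 1) (k + 1)"
        by (rule carr[OF corner_gen_carrier corner_gen_carrier])
      show "(q - inverse q) \<cdot>\<^sub>m ?S i + 1\<^sub>m (k + 1) \<in> carrier_mat (k + 1) (k + 1)"
        by (rule add_carrier_mat[OF one_carrier_mat])
    qed
    then show ?thesis
      unfolding quadratic(2)
      by (intro diff)
        (simp only: corner_free_mult corner_free_gen corner_free_add corner_free_one
          corner_free_scalar)
  qed
qed

lemma corner_free_ideal:
  assumes "x \<in> hecke_ideal q (k + 2)"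
  shows "corner_free q k x = 0\<^sub>m (k + 1) (k + 1)"
proof -
  let ?R = "free_algebra (k + 2)" and ?M = "ring_mat TYPE(complex) (k + 1) ()"
  interpret ring_hom_ring ?R ?M "corner_free q k"
    by (intro ring_hom_ringI2 ring_free_algebra ring_mat corner_free_hom)
  have ker: "a_kernel ?R ?M (corner_free q k) =
      {x \<in> carrier ?R. corner_free q k x = 0\<^sub>m (k + 1) (k + 1)}"
    by (simp only: a_kernel_def' ring_mat_simps)
  have "hecke_relators q (k + 2) \<subseteq> a_kernel ?R ?M (corner_free q k)"
    unfolding ker using hecke_relators_carrier corner_free_relator by blast
  then have "hecke_ideal q (k + 2) \<subseteq> a_kernel ?R ?M (corner_free q k)"
    unfolding hecke_ideal_def
    by (rule ring.genideal_minimal[OF ring_free_algebra kernel_is_ideal])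
  with assms show ?thesis
    unfolding ker by blast
qed

lemma corner_rep_class:
  assumes "x \<in> carrier (free_algebra (k + 2))"
  shows "corner_rep q k (hecke_class q (k + 2) x) = corner_free q k x"
proof -
  interpret ideal "hecke_ideal q (k + 2)" "free_algebra (k + 2)" by (rule ideal_hecke_ideal)
  have "corner_free q k y = corner_free q k x" if "y \<in> hecke_class q (k + 2) x" for y
  proof -
    obtain h where "h \<in> hecke_ideal q (k + 2)" "y = h + x"
      using \<open>y \<in> hecke_class q (k + 2) x\<close> by (auto simp: hecke_class_def a_r_coset_def')
    then show ?thesis
      by (simp add: corner_free_add corner_free_ideal left_add_zero_mat[OF corner_free_carrier]
          del: One_nat_def add_Suc_right)
  qed
  moreover have "x \<in> hecke_class q (k + 2) x"
    unfolding hecke_class_def by (rule a_rcos_self[OF assms])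
  ultimately have "corner_free q k ` hecke_class q (k + 2) x = {corner_free q k x}"
    by blast
  then show ?thesis by (simp only: corner_rep_def the_elem_eq)
qed

lemma hecke_algebra_cases:
  assumes "X \<in> carrier (hecke_algebra q m)"
  obtains x where "x \<in> carrier (free_algebra m)" "X = hecke_class q m x"
  using assms unfolding hecke_algebra_def hecke_class_def FactRing_def A_RCOSETS_def' by auto

lemma corner_rep_hom:
  "corner_rep q k \<in>
     Ring.ring_hom (hecke_algebra q (k + 2)) (ring_mat TYPE(complex) (k + 1) ())"
proof -
  interpret F: ring "free_algebra (k + 2)" by (rule ring_free_algebra)
  note c = hecke_class_hom[of q "k + 2"] and f = corner_free_hom[of q k "k + 2"]
  show ?thesis
  proof (rule ring_hom_memI)
    fix X assume "X \<in> carrier (hecke_algebra q (k + 2))"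
    then show "corner_rep q k X \<in> carrier (ring_mat TYPE(complex) (k + 1) ())"
      by (elim hecke_algebra_cases)
        (simp only: corner_rep_class ring_mat_simps corner_free_carrier)
  next
    fix X Y
    assume "X \<in> carrier (hecke_algebra q (k + 2))" "Y \<in> carrier (hecke_algebra q (k + 2))"
    then obtain x y where x: "x \<in> carrier (free_algebra (k + 2))" "X = hecke_class q (k + 2) x"
      and y: "y \<in> carrier (free_algebra (k + 2))" "Y = hecke_class q (k + 2) y"
      by (metis hecke_algebra_cases)
    show "corner_rep q k (X \<otimes>\<^bsub>hecke_algebra q (k + 2)\<^esub> Y) =
        corner_rep q k X \<otimes>\<^bsub>ring_mat TYPE(complex) (k + 1) ()\<^esub> corner_rep q k Y"
      by (simp only: x(2) y(2) ring_hom_mult[OF c x(1) y(1), symmetric]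
          corner_rep_class[OF x(1)] corner_rep_class[OF y(1)]
          corner_rep_class[OF F.m_closed[OF x(1) y(1)]] ring_hom_mult[OF f x(1) y(1)])
    show "corner_rep q k (X \<oplus>\<^bsub>hecke_algebra q (k + 2)\<^esub> Y) =
        corner_rep q k X \<oplus>\<^bsub>ring_mat TYPE(complex) (k + 1) ()\<^esub> corner_rep q k Y"
      by (simp only: x(2) y(2) ring_hom_add[OF c x(1) y(1), symmetric]
          corner_rep_class[OF x(1)] corner_rep_class[OF y(1)]
          corner_rep_class[OF F.a_closed[OF x(1) y(1)]] ring_hom_add[OF f x(1) y(1)])
  next
    show "corner_rep q k \<one>\<^bsub>hecke_algebra q (k + 2)\<^esub> = \<one>\<^bsub>ring_mat TYPE(complex) (k + 1) ()\<^esub>"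
      by (simp only: ring_hom_one[OF c, symmetric] corner_rep_class[OF F.one_closed]
          ring_hom_one[OF f])
  qed
qed

lemma corner_rep_sigma:
  assumes "p \<in> {1..k + 1}"
  shows "corner_rep q k (hecke_sigma q (k + 2) p) = corner_gen q k p"
  unfolding hecke_sigma_def using assms
  by (subst corner_rep_class[OF gen_carrier]) (auto simp: corner_free_gen)

lemma corner_rep_scalar:
  "corner_rep q k (hecke_class q (k + 2) (scalar c)) = c \<cdot>\<^sub>m 1\<^sub>m (k + 1)"
  by (simp only: corner_rep_class[OF scalar_carrier] corner_free_scalar)

end

end

theory Submission
  imports Defs
begin

text \<open>
  Since \<open>\<rho>(\<sigma>\<^sub>p) - q\<close> has rank one, the Hamiltonian sends \<open>f\<close> to
  \<open>\<Sum>\<^sub>p (f p - f (p + 1)) corner_vec q p + (q + 1/q) f\<close>. In the coordinates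
  \<open>y\<^sub>p = (f p - f (p + 1)) / (p)\<^sub>q\<close> (with \<open>f 1 = 0\<close>) this is the adjacency operator
  \<open>y\<^sub>p \<mapsto> y\<^bsub>p-1\<^esub> + y\<^bsub>p+1\<^esub>\<close> of the path with \<open>k + 1\<close> vertices, whose eigenvectors are
  \<open>y\<^sub>r = sin (r m \<pi> / (k + 2))\<close>. The resulting \<open>k + 1\<close> eigenvalues are distinct, so there are no others.
\<close>

lemma qint_1 [simp]: "qint q (Suc 0) = 1"
  by (simp add: qint_def)

text \<open>The Chebyshev-type recurrence of the quantum integers: the same three-term form as the
  recurrence for \<open>y\<close>, with \<open>q + inverse q\<close> in place of
  \<open>l\<close>.\<close>

lemma qint_Suc_Suc:
  assumes "q \<noteq> 0"
  shows "qint q (Suc (Suc p)) + qint q p = (q + inverse q) * qint q (Suc p)"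
proof -
  have "qint q (Suc (Suc p)) = q * qint q (Suc p) + inverse q * inverse q ^ p"
    using qint_Suc[OF assms, of "Suc p"] by simp
  moreover have "inverse q * qint q (Suc p) = qint q p + inverse q * inverse q ^ p"
    using assms by (simp add: qint_Suc[OF assms, of p] algebra_simps)
  ultimately show ?thesis by (simp add: algebra_simps)
qed

text \<open>The ring homomorphism \<open>corner_rep\<close> turns the sum formed in the quotient
  ring into an entrywise sum of matrices. A general \<open>A\<close> makes induction on the index
  set possible.\<close>

lemma corner_rep_sum_sigma:
  assumes "q \<noteq> 0" "(\<Prod>p = 1..k + 1. qint q p) \<noteq> 0"
    and "finite A" "A \<subseteq> {1..k + 1}"
  shows "corner_rep q k (\<Oplus>\<^bsub>hecke_algebra q (k + 2)\<^esub>i \<in> A. hecke_sigma q (k + 2) i) =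
    mat (k + 1) (k + 1) (\<lambda>rc. \<Sum>p\<in>A. corner_gen q k p $$ rc)"
proof -
  let ?H = "hecke_algebra q (k + 2)" and ?M = "ring_mat TYPE(complex) (k + 1) ()"
  interpret H: ring ?H by (rule ring_hecke_algebra)
  interpret h: ring_hom_ring ?H ?M "corner_rep q k"
    by (intro ring_hom_ringI2 ring_hecke_algebra ring_mat corner_rep_hom assms(1,2))
  have closed: "hecke_sigma q (k + 2) i \<in> carrier ?H" if "i \<in> {1..k + 1}" for i
    unfolding hecke_sigma_def using that
    by (intro ring_hom_closed[OF hecke_class_hom] gen_carrier) auto
  show ?thesis
    using assms(3,4)
  proof (induction A rule: finite_induct)
    case empty
    have "corner_rep q k \<zero>\<^bsub>?H\<^esub> = 0\<^sub>m (k + 1) (k + 1)"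
      using h.hom_zero by (simp only: ring_mat_simps)
    then show ?case
      by (simp only: H.finsum_empty) (auto intro!: eq_matI)
  next
    case (insert a A)
    let ?s = "hecke_sigma q (k + 2)"
    have s: "?s \<in> A \<rightarrow> carrier ?H" "?s a \<in> carrier ?H"
      using insert.prems closed by auto
    have "corner_rep q k (\<Oplus>\<^bsub>?H\<^esub>i \<in> insert a A. ?s i) =
        corner_rep q k (?s a) + corner_rep q k (\<Oplus>\<^bsub>?H\<^esub>i \<in> A. ?s i)"
      unfolding H.finsum_insert[OF insert.hyps s] h.hom_add[OF s(2) H.finsum_closed[OF s(1)]]
      by (simp only: ring_mat_simps)
    also have "corner_rep q k (?s a) = corner_gen q k a"
      using insert.prems by (intro corner_rep_sigma assms(1,2)) auto
    finally show ?case
      using insert corner_gen_carrier[of q k a] by (auto intro!: eq_matI)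
  qed
qed

lemma corner_hamiltonian_carrier:
  assumes "q \<noteq> 0" "(\<Prod>p = 1..k + 1. qint q p) \<noteq> 0"
  shows "corner_hamiltonian q k \<in> carrier_mat (k + 1) (k + 1)"
  unfolding corner_hamiltonian_def by (rule minus_carrier_mat) simp

lemma corner_gen_mult_vec:
  assumes "q \<noteq> 0" "p \<in> {1..<k + 2}" "qint q p \<noteq> 0" "f 1 = 0" "r < k + 1"
  shows "(\<Sum>s<k + 1. corner_gen q k p $$ (r, s) * f (s + 2)) = corner_act q p f (r + 2)"
proof -
  \<comment> \<open>Every column of \<open>F\<close> is the same vector, so that
    \<open>corner_col_mult\<close>, which concerns square matrices, applies; column 0 is then read
    off.\<close>
  define F where "F = mat (k + 1) (k + 1) (\<lambda>(r, c). f (r + 2))"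
  have F: "F \<in> carrier_mat (k + 1) (k + 1)"
    by (simp add: F_def)
  have "(\<Sum>s<k + 1. corner_gen q k p $$ (r, s) * f (s + 2)) = (corner_gen q k p * F) $$ (r, 0)"
    using assms(5) corner_gen_carrier[of q k p]
    by (auto simp: F_def scalar_prod_def lessThan_atLeast0 simp del: add_2_eq_Suc' intro!: sum.cong)
  also have "\<dots> = corner_col k (corner_gen q k p * F) 0 (r + 2)"
    using assms(5) by (simp add: corner_col_def)
  also have "\<dots> = corner_act q p (corner_col k F 0) (r + 2)"
    by (subst corner_col_mult[OF assms(1-3) F]) simp_all
  also have "\<dots> = corner_act q p f (r + 2)"
  proof -
    \<comment> \<open>Index 1 matters because \<open>corner_act\<close> reads \<open>f p\<close> at
      \<open>p = 1\<close>; there \<open>corner_col\<close> has the default value 0, which agrees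
      with \<open>f 1 = 0\<close>.\<close>
    have "corner_col k F 0 j = f j" if "j \<in> {1..k + 2}" for j
    proof (cases "j = 1")
      case False
      then have "j - 2 + 2 = j" using that by auto
      with False that show ?thesis by (auto simp: corner_col_def F_def simp del: add_2_eq_Suc')
    qed (use assms(4) in \<open>simp add: corner_col_def\<close>)
    then show ?thesis using assms(2,5) by (simp add: corner_act_def)
  qed
  finally show ?thesis .
qed

text \<open>The \<open>k + 1\<close> generators each contribute a scalar part \<open>q\<close>;
  subtracting \<open>q * k - inverse q\<close> leaves \<open>q + inverse q\<close> beside the
  rank-one parts.\<close>

lemma corner_hamiltonian_mult_vec:
  assumes "q \<noteq> 0" "(\<Prod>p = 1..k + 1. qint q p) \<noteq> 0" "f 1 = 0" "r < k + 1"
  shows "(corner_hamiltonian q k *\<^sub>v vec (k + 1) (\<lambda>s. f (s + 2))) $ r =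
    (\<Sum>p = 1..k + 1. (f p - f (p + 1)) * corner_vec q p (r + 2)) + (q + inverse q) * f (r + 2)"
proof -
  let ?c = "q * of_nat k - inverse q"
  let ?S = "corner_gen q k"
  have H: "corner_hamiltonian q k $$ (r, s) =
      (\<Sum>p = 1..k + 1. ?S p $$ (r, s)) - (if s = r then ?c else 0)" if "s < k + 1" for s
    unfolding corner_hamiltonian_def corner_rep_sum_sigma[OF assms(1,2) finite_atLeastAtMost subset_refl]
    using assms(4) that by (auto simp del: sum.cl_ivl_Suc)
  have "(corner_hamiltonian q k *\<^sub>v vec (k + 1) (\<lambda>s. f (s + 2))) $ r =
      (\<Sum>s<k + 1. corner_hamiltonian q k $$ (r, s) * f (s + 2))"
    using corner_hamiltonian_carrier[OF assms(1,2)] assms(4)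
    by (auto simp: scalar_prod_def lessThan_atLeast0 simp del: add_2_eq_Suc' intro!: sum.cong)
  also have "\<dots> = (\<Sum>s<k + 1. (\<Sum>p = 1..k + 1. ?S p $$ (r, s) * f (s + 2)) -
      (if s = r then ?c * f (r + 2) else 0))"
    by (intro sum.cong refl) (simp add: H left_diff_distrib sum_distrib_right del: sum.cl_ivl_Suc)
  also have "\<dots> = (\<Sum>s<k + 1. \<Sum>p = 1..k + 1. ?S p $$ (r, s) * f (s + 2)) - ?c * f (r + 2)"
    using assms(4) by (simp only: sum_subtractf sum.delta[OF finite_lessThan]) simp
  also have "(\<Sum>s<k + 1. \<Sum>p = 1..k + 1. ?S p $$ (r, s) * f (s + 2)) =
      (\<Sum>p = 1..k + 1. \<Sum>s<k + 1. ?S p $$ (r, s) * f (s + 2))"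
    by (rule sum.swap)
  also have "\<dots> = (\<Sum>p = 1..k + 1. corner_act q p f (r + 2))"
    using qint_nz[OF assms(1,2)] assms by (intro sum.cong corner_gen_mult_vec) auto
  also have "\<dots> = of_nat (k + 1) * (q * f (r + 2)) +
      (\<Sum>p = 1..k + 1. (f p - f (p + 1)) * corner_vec q p (r + 2))"
    unfolding corner_act_def sum.distrib sum_constant card_atLeastAtMost by simp
  finally show ?thesis by (simp add: algebra_simps)
qed

lemma eigenvalue_corner_hamiltonian:
  fixes y :: "nat \<Rightarrow> complex"
  assumes "q \<noteq> 0" "(\<Prod>p = 1..k + 1. qint q p) \<noteq> 0"
    and y: "y 0 = 0" "y 1 \<noteq> 0" "y (k + 2) = 0"
    and rec: "\<And>r. y (Suc (Suc r)) + y r = l * y (Suc r)"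
  shows "eigenvalue (corner_hamiltonian q k) l"
proof -
  \<comment> \<open>This inverts the change of coordinates by summation; \<open>f 1 = 0\<close>
    since \<open>qint q 0 = 0\<close>.\<close>
  define f where "f j = - (\<Sum>r<j. qint q r * y r)" for j
  let ?v = "vec (k + 1) (\<lambda>s. f (s + 2))" and ?H = "corner_hamiltonian q k"
  note H = corner_hamiltonian_carrier[OF assms(1,2)]
  have f1: "f 1 = 0" by (simp add: f_def)
  have diff: "f j - f (Suc j) = qint q j * y j" for j by (simp add: f_def)
  \<comment> \<open>A discrete Wronskian: by the two recurrences,
    \<open>qint q (j + 1) * y j - qint q j * y (j + 1)\<close> grows from \<open>j\<close> to
    \<open>j + 1\<close> by \<open>(q + inverse q - l) * qint q (j + 1) * y (j + 1)\<close>, which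
    is \<open>l - q - inverse q\<close> times the increment of \<open>f\<close>.\<close>
  have telescope: "qint q (Suc j) * y j - qint q j * y (Suc j) + (q + inverse q) * f (Suc j) =
      l * f (Suc j)" for j
  proof (induction j)
    case 0
    then show ?case using y f1 by simp
  next
    case (Suc j)
    have 1: "y (Suc (Suc j)) = l * y (Suc j) - y j"
      using rec[of j] by (simp add: eq_diff_eq)
    have 2: "qint q (Suc (Suc j)) = (q + inverse q) * qint q (Suc j) - qint q j"
      using qint_Suc_Suc[OF assms(1), of j] by (simp add: eq_diff_eq)
    have 3: "f (Suc (Suc j)) = f (Suc j) - qint q (Suc j) * y (Suc j)"
      using diff[of "Suc j"] by (simp add: algebra_simps)
    show ?case unfolding 1 2 3 using Suc by (simp add: algebra_simps)
  qed
  have "?H *\<^sub>v ?v = l \<cdot>\<^sub>v ?v"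
  proof (rule eq_vecI)
    fix r assume "r < dim_vec (l \<cdot>\<^sub>v ?v)"
    then have r: "r < k + 1" by simp
    \<comment> \<open>\<open>corner_vec q p\<close> is supported on \<open>p\<close> and
      \<open>p + 1\<close>, and its denominator cancels the factor \<open>qint q p\<close> of the
      difference.\<close>
    have "(f p - f (p + 1)) * corner_vec q p (r + 2) =
        (if p = r + 2 then - (qint q (r + 1) * y (r + 2)) else 0) +
        (if p = r + 1 then qint q (r + 2) * y (r + 1) else 0)" if "p \<in> {1..k + 1}" for p
      using that qint_nz[OF assms(1,2), of p] diff[of p] by (auto simp: corner_vec_def)
    then have "(\<Sum>p = 1..k + 1. (f p - f (p + 1)) * corner_vec q p (r + 2)) =
        (\<Sum>p = 1..k + 1. (if p = r + 2 then - (qint q (r + 1) * y (r + 2)) else 0) +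
        (if p = r + 1 then qint q (r + 2) * y (r + 1) else 0))"
      by (intro sum.cong) auto
    also have "\<dots> = (if r + 2 \<in> {1..k + 1} then - (qint q (r + 1) * y (r + 2)) else 0) +
        (if r + 1 \<in> {1..k + 1} then qint q (r + 2) * y (r + 1) else 0)"
      by (simp only: sum.distrib sum.delta[OF finite_atLeastAtMost])
    also have "\<dots> = qint q (r + 2) * y (r + 1) - qint q (r + 1) * y (r + 2)"
    \<comment> \<open>In the last row the index \<open>r + 2\<close> falls outside the sum; the
      boundary condition \<open>y (k + 2) = 0\<close> accounts for the missing term.\<close>
    proof (cases "r = k")
      case True
      then show ?thesis using y(3) by simp
    qed (use r in simp)
    finally have "(?H *\<^sub>v ?v) $ r = l * f (r + 2)"
      unfolding corner_hamiltonian_mult_vec[of q k f r, OF assms(1,2) f1 r]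
      using telescope[of "r + 1"] by simp
    then show "(?H *\<^sub>v ?v) $ r = (l \<cdot>\<^sub>v ?v) $ r"
      using r by simp
  qed (use H in simp)
  moreover have "?v \<noteq> 0\<^sub>v (k + 1)"
  proof
    assume "?v = 0\<^sub>v (k + 1)"
    \<comment> \<open>Entry 0 is \<open>f 2 = - y 1\<close>, which is nonzero.\<close>
    then have "?v $ 0 = 0" by simp
    then have "f 2 = 0" by (simp add: numeral_2_eq_2)
    then show False
      using diff[of 1] f1 y(2) by (simp add: numeral_2_eq_2)
  qed
  ultimately show ?thesis
    using H unfolding eigenvalue_def eigenvector_def by (intro exI[of _ ?v]) auto
qed

theorem theorem3p1:
  fixes q :: complex and k :: nat
  assumes "q \<noteq> 0"
    and "(\<Prod>p = 1..k + 1. qint q p) \<noteq> 0"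
  shows "spectrum (corner_hamiltonian q k) =
    {complex_of_real (2 * cos (pi * real p / real (k + 2))) |p. p \<in> {1..k + 1}}"
proof -
  define t where "t p = pi * real p / real (k + 2)" for p
  define c where "c p = complex_of_real (2 * cos (t p))" for p
  have t: "0 < t p" "t p < pi" if "p \<in> {1..k + 1}" for p
    using that by (auto simp: t_def field_simps simp flip: of_nat_Suc of_nat_add)
  have "eigenvalue (corner_hamiltonian q k) (c m)" if m: "m \<in> {1..k + 1}" for m
  proof (rule eigenvalue_corner_hamiltonian[OF assms])
    let ?y = "\<lambda>r. complex_of_real (sin (real r * t m))"
    have "sin (t m) \<noteq> 0" using sin_gt_zero[OF t[OF m]] by simp
    then show "?y 1 \<noteq> 0" by simp
    have "real (k + 2) * t m = real m * pi" by (simp add: t_def)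
    then show "?y (k + 2) = 0" by (simp only: sin_npi of_real_0)
    \<comment> \<open>The identity sin (x + t) + sin (x - t) = 2 cos t sin x, centred at
      \<open>x = a + t m\<close>, is the path recurrence.\<close>
    have "sin (a + t m + t m) + sin a = 2 * cos (t m) * sin (a + t m)" for a
      using sin_add[of "a + t m" "t m"] sin_diff[of "a + t m" "t m"] by simp
    from this[of "real r * t m" for r]
    show "?y (Suc (Suc r)) + ?y r = c m * ?y (Suc r)" for r
      unfolding c_def of_real_mult[symmetric] of_real_add[symmetric] of_real_eq_iff
      by (simp add: algebra_simps)
  qed simp
  then have sub: "c ` {1..k + 1} \<subseteq> spectrum (corner_hamiltonian q k)"
    by (auto simp: spectrum_def)
  have "inj_on c {1..k + 1}"
  proof (rule inj_onI)
    fix i j assume i: "i \<in> {1..k + 1}" and j: "j \<in> {1..k + 1}" and "c i = c j"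
    then have "cos (t i) = cos (t j)" by (simp add: c_def)
    then have "t i = t j" using t[OF i] t[OF j] cos_inj_pi[of "t i" "t j"] by simp
    then show "i = j" by (simp add: t_def)
  qed
  then have "card (c ` {1..k + 1}) = k + 1" by (simp add: card_image)
  \<comment> \<open>A matrix of size \<open>k + 1\<close> has at most \<open>k + 1\<close>
    eigenvalues, so the distinct ones already found exhaust the spectrum.\<close>
  with card_finite_spectrum[OF corner_hamiltonian_carrier[OF assms]] sub
  have "c ` {1..k + 1} = spectrum (corner_hamiltonian q k)"
    by (intro card_seteq) auto
  then show ?thesis unfolding c_def t_def by blast
qed

end
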